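(* Let $n,t,s$ be positive integers with $n\geq 5s(t+1)^{2}$. Suppose that $\mathcal{F},\mathcal{G}\subseteq\binom{[n]}{t+1}$ are $s$-almost cross-$t$-intersecting but not cross-$t$-intersecting families with $|\mathcal{F}|\leq|\mathcal{G}|$, and that $|\mathcal{F}||\mathcal{G}|$ is maximum among all such pairs. (i) If $t\geq s+2$, then there exists $Y\in\binom{[n]}{t+1}$ such that $\mathcal{F}=\{Y\}$ and $\mathcal{G}=\mathcal{M}_1(Y;t+1,t)\cup\mathcal{C}$, where $\mathcal{C}$ is an $s$-subset of $\binom{[n]}{t+1}\setminus\mathcal{M}_1(Y;t+1,t)$. (ii) If $t\leq s+1$, then there exist $Z\in\binom{[n]}{t+s+2}$ and $W\in\binom{Z}{t}$ such that $\mathcal{F}=\mathcal{H}_1(Z,W;t+1)$ and $\mathcal{G}=\mathcal{H}_1([n],W;t+1)\cup\mathcal{D}$, where $\mathcal{D}$ is an $(s+2)$-subset of $\mathcal{M}_2(Z,W;t)$ such that each element of $Z\setminus W$ is contained in exactly two members of $\mathcal{D}$.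
   Context: $[n]=\{1,\dots,n\}$ and $\binom{X}{k}$ denotes the family of all $k$-subsets of a set $X$. Two sets $F,G$ are $t$-intersecting if $|F\cap G|\geq t$ and $t$-disjoint otherwise. Families $\mathcal{F},\mathcal{G}$ are cross-$t$-intersecting if every member of $\mathcal{F}$ and every member of $\mathcal{G}$ are $t$-intersecting; they are $s$-almost cross-$t$-intersecting if each member of $\mathcal{F}$ is $t$-disjoint with at most $s$ members of $\mathcal{G}$ and each member of $\mathcal{G}$ is $t$-disjoint with at most $s$ members of $\mathcal{F}$. For subsets $W\subseteq X$ and $Y$ of $[n]$: $\mathcal{H}_1(X,W;k)=\{F\in\binom{X}{k}: W\subseteq F\}$, $\mathcal{M}_1(Y;k,t)=\{F\in\binom{[n]}{k}: |F\cap Y|\geq t\}$, and $\mathcal{M}_2(X,W;t)=\{F\in\binom{X}{t+1}: |F\cap W|=t-1\}$. *)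

theory Defs
  imports Main "HOL-Library.Ramsey"
begin

(* The family of all k-subsets of X is the library's "nsets X k", written [X] with superscript k. *)

definition t_intersecting :: "nat \<Rightarrow> 'a set \<Rightarrow> 'a set \<Rightarrow> bool" where
  "t_intersecting t F G \<longleftrightarrow> card (F \<inter> G) \<ge> t"

abbreviation t_disjoint :: "nat \<Rightarrow> 'a set \<Rightarrow> 'a set \<Rightarrow> bool" where
  "t_disjoint t F G \<equiv> \<not> t_intersecting t F G"

definition cross_intersecting :: "nat \<Rightarrow> 'a set set \<Rightarrow> 'a set set \<Rightarrow> bool" where
  "cross_intersecting t \<F> \<G> \<longleftrightarrow> (\<forall>F\<in>\<F>. \<forall>G\<in>\<G>. t_intersecting t F G)"

(* Only used for finite families, so "card" really counts. *)
definition almost_cross_intersecting ::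
    "nat \<Rightarrow> nat \<Rightarrow> 'a set set \<Rightarrow> 'a set set \<Rightarrow> bool" where
  "almost_cross_intersecting s t \<F> \<G> \<longleftrightarrow>
     (\<forall>F\<in>\<F>. card {G \<in> \<G>. t_disjoint t F G} \<le> s) \<and>
     (\<forall>G\<in>\<G>. card {F \<in> \<F>. t_disjoint t G F} \<le> s)"

definition H1 :: "'a set \<Rightarrow> 'a set \<Rightarrow> nat \<Rightarrow> 'a set set" where
  "H1 X W k = {F \<in> nsets X k. W \<subseteq> F}"

(* The ground set [n], implicit on paper, is an explicit argument here. *)
definition M1 :: "nat \<Rightarrow> nat set \<Rightarrow> nat \<Rightarrow> nat \<Rightarrow> nat set set" where
  "M1 n Y k t = {F \<in> nsets {1..n} k. card (F \<inter> Y) \<ge> t}"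

(* |F \<inter> W| = t - 1, written without truncated subtraction. *)
definition M2 :: "'a set \<Rightarrow> 'a set \<Rightarrow> nat \<Rightarrow> 'a set set" where
  "M2 X W t = {F \<in> nsets X (t + 1). card (F \<inter> W) + 1 = t}"

definition admissible_pair :: "nat \<Rightarrow> nat \<Rightarrow> nat \<Rightarrow> nat set set \<Rightarrow> nat set set \<Rightarrow> bool" where
  "admissible_pair n t s \<F> \<G> \<longleftrightarrow>
     \<F> \<subseteq> nsets {1..n} (t + 1) \<and> \<G> \<subseteq> nsets {1..n} (t + 1) \<and>
     almost_cross_intersecting s t \<F> \<G> \<and> \<not> cross_intersecting t \<F> \<G> \<and>
     card \<F> \<le> card \<G>"

end

theory Submission
  imports Defs
begin

text \<open>
  Call two \<open>(t + 1)\<close>-sets adjacent if they meet in at least \<open>t\<close> points. All but a bounded number of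
  members of \<open>\<G>\<close> are adjacent to any given few members of \<open>\<F>\<close>. Two non-adjacent sets have at most 4
  common neighbours, and three pairwise adjacent sets without a common \<open>t\<close>-subset have at most
  \<open>t + 2\<close>, so in both cases \<open>|\<F>| \<le> |\<G>| \<le> t + 2 + 3s\<close>, which is too small. Hence \<open>\<F>\<close> is a single set or
  a star with a \<open>t\<close>-element centre \<open>W\<close>. A member of \<open>\<G>\<close> not containing \<open>W\<close> is adjacent to at most two
  members of the star, so \<open>|\<F>| \<le> s + 2\<close>, and double counting the non-adjacent pairs bounds the number
  of such members. The product is therefore about \<open>(t + 1) n\<close> for a single set and at most about
  \<open>(s + 2) n\<close> for a star, and comparison with the two extremal examples decides between them.
\<close>

section \<open>Shape and size of stars \<open>H1\<close> and balls \<open>M1\<close>\<close>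

lemma mem_nsets: "F \<in> nsets X k \<longleftrightarrow> F \<subseteq> X \<and> finite F \<and> card F = k"
  by (auto simp: nsets_def)

lemma H1_eq_image:
  assumes "finite W" "card W = t" "W \<subseteq> X"
  shows "H1 X W (t + 1) = (\<lambda>x. insert x W) ` (X - W)"
proof (intro equalityI subsetI)
  fix F assume "F \<in> H1 X W (t + 1)"
  then have F: "F \<subseteq> X" "finite F" "card F = t + 1" "W \<subseteq> F"
    by (auto simp: H1_def mem_nsets)
  then have "card (F - W) = 1"
    using assms by (simp add: card_Diff_subset)
  then obtain x where "F - W = {x}" by (auto simp: card_1_singleton_iff)
  then have "F = insert x W" "x \<in> X - W" using F by auto
  then show "F \<in> (\<lambda>x. insert x W) ` (X - W)" by blast
qed (use assms in \<open>auto simp: H1_def mem_nsets\<close>)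

lemma card_H1:
  assumes "finite X" "card W = t" "W \<subseteq> X"
  shows "card (H1 X W (t + 1)) = card X - t"
proof -
  have "finite W" using assms finite_subset by blast
  moreover have "inj_on (\<lambda>x. insert x W) (X - W)" by (auto simp: inj_on_def)
  ultimately show ?thesis
    using assms H1_eq_image[of W t X] by (simp add: card_image card_Diff_subset)
qed

text \<open>A set that meets \<open>Y\<close> in exactly \<open>t\<close> points arises from
  \<open>Y\<close> by exchanging one point \<open>y\<close> of \<open>Y\<close> for one point
  \<open>x\<close> outside; a larger intersection forces the set to be \<open>Y\<close>
  itself.\<close>

lemma M1_eq_image:
  assumes "Y \<in> nsets {1..n} (t + 1)"
  shows "M1 n Y (t + 1) t =
    insert Y ((\<lambda>(y, x). insert x (Y - {y})) ` (Y \<times> ({1..n} - Y)))"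
proof (intro equalityI subsetI)
  have Y: "Y \<subseteq> {1..n}" "finite Y" "card Y = t + 1" using assms by (auto simp: mem_nsets)
  fix F assume "F \<in> M1 n Y (t + 1) t"
  then have F: "F \<subseteq> {1..n}" "finite F" "card F = t + 1" "t \<le> card (F \<inter> Y)"
    by (auto simp: M1_def mem_nsets)
  show "F \<in> insert Y ((\<lambda>(y, x). insert x (Y - {y})) ` (Y \<times> ({1..n} - Y)))"
  proof (cases "card (F \<inter> Y) = t")
    case True
    then have "card (F - Y) = 1" "card (Y - F) = 1"
      using F Y by (simp_all add: card_Diff_subset_Int Int_commute)
    then obtain x y where "F - Y = {x}" "Y - F = {y}" by (auto simp: card_1_singleton_iff)
    then have "F = insert x (Y - {y})" "y \<in> Y" "x \<in> {1..n} - Y" using F by auto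
    then show ?thesis by (auto intro!: image_eqI[of _ _ "(y, x)"])
  next
    case False
    then have "card F \<le> card (F \<inter> Y)" "card Y \<le> card (F \<inter> Y)" using F Y by auto
    then have "F \<inter> Y = F" "F \<inter> Y = Y"
      using card_seteq[OF F(2) Int_lower1] card_seteq[OF Y(2) Int_lower2] by blast+
    then have "F = Y" by blast
    then show ?thesis by simp
  qed
next
  have Y: "Y \<subseteq> {1..n}" "finite Y" "card Y = t + 1" using assms by (auto simp: mem_nsets)
  fix F assume "F \<in> insert Y ((\<lambda>(y, x). insert x (Y - {y})) ` (Y \<times> ({1..n} - Y)))"
  then consider "F = Y" | x y where "y \<in> Y" "x \<in> {1..n} - Y" "F = insert x (Y - {y})" by auto
  then show "F \<in> M1 n Y (t + 1) t"
  proof cases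
    case 1
    then show ?thesis using Y by (auto simp: M1_def mem_nsets)
  next
    case 2
    then have "F \<inter> Y = Y - {y}" by auto
    then show ?thesis using Y 2 by (auto simp: M1_def mem_nsets)
  qed
qed

lemma card_M1:
  assumes "Y \<in> nsets {1..n} (t + 1)"
  shows "card (M1 n Y (t + 1) t) = (t + 1) * (n - t - 1) + 1"
proof -
  have Y: "Y \<subseteq> {1..n}" "finite Y" "card Y = t + 1" using assms by (auto simp: mem_nsets)
  have "inj_on (\<lambda>(y, x). insert x (Y - {y})) (Y \<times> ({1..n} - Y))"
  proof (rule inj_onI, clarify)
    fix y x y' x'
    assume xy: "y \<in> Y" "y' \<in> Y" "x \<notin> Y" "x' \<notin> Y"
      and eq: "insert x (Y - {y}) = insert x' (Y - {y'})"
    \<comment> \<open>The exchanged points are recovered as the two differences with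
      \<open>Y\<close>, so distinct exchanges give distinct sets.\<close>
    have "Y - insert x (Y - {y}) = {y}" "Y - insert x' (Y - {y'}) = {y'}"
      "insert x (Y - {y}) - Y = {x}" "insert x' (Y - {y'}) - Y = {x'}"
      using xy by auto
    with eq show "y = y' \<and> x = x'" by auto
  qed
  moreover have "Y \<notin> (\<lambda>(y, x). insert x (Y - {y})) ` (Y \<times> ({1..n} - Y))" by auto
  moreover have "card ({1..n} - Y) = n - t - 1" using Y by (simp add: card_Diff_subset)
  ultimately show ?thesis
    using Y M1_eq_image[OF assms] by (simp add: card_image card_cartesian_product)
qed

lemma finite_M1: "finite (M1 n Y k t)"
  by (simp add: M1_def finite_imp_finite_nsets)

section \<open>Common neighbours of two or three sets of size \<open>t + 1\<close>\<close>

lemma card_nsets_Suc: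
  assumes "finite U" "card U = Suc k"
  shows "card (nsets U k) = Suc k"
proof -
  have "nsets U k = {A. A \<subseteq> U \<and> card A = k}"
    using assms finite_subset by (auto simp: nsets_def)
  then show ?thesis using assms n_subsets[of U k] by simp
qed

text \<open>If \<open>D\<close> has a point \<open>x\<close> outside both sets, the other
  \<open>t\<close> points of \<open>D\<close> must all lie in \<open>F1\<close> and in
  \<open>F2\<close>. They then fill up \<open>F1 \<inter> F2\<close>, which has no room for more
  than \<open>t\<close>.\<close>

lemma adjacent_both_cases:
  assumes "finite F1" "finite F2" "finite D" "card D = t + 1" "card (F1 \<inter> F2) \<le> t"
    and "t \<le> card (D \<inter> F1)" "t \<le> card (D \<inter> F2)"
  shows "F1 \<inter> F2 \<subseteq> D \<or> D \<subseteq> F1 \<union> F2"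
proof (rule disjCI)
  assume "\<not> D \<subseteq> F1 \<union> F2"
  then obtain x where x: "x \<in> D" "x \<notin> F1" "x \<notin> F2" by auto
  have c: "card (D - {x}) = t" using assms x by simp
  have "D \<inter> F1 = D - {x}" "D \<inter> F2 = D - {x}"
    using assms x c card_seteq[of "D - {x}" "D \<inter> F1"] card_seteq[of "D - {x}" "D \<inter> F2"] by auto
  then have "D - {x} \<subseteq> F1 \<inter> F2" by auto
  then have "D - {x} = F1 \<inter> F2" using assms c by (intro card_seteq) auto
  then show "F1 \<inter> F2 \<subseteq> D" by auto
qed

text \<open>A neighbour \<open>D\<close> not inside \<open>F1 \<union> F2\<close> would contain
  \<open>F1 \<inter> F2\<close> and \<open>F1 \<inter> F3\<close>. These are distinct
  \<open>t\<close>-subsets of the \<open>(t + 1)\<close>-set \<open>F1\<close>, so their union is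
  \<open>F1\<close> and \<open>D = F1\<close>, a contradiction.\<close>

lemma adjacent_triple_subset:
  assumes fin: "finite F1" "finite F2" "finite F3" "finite D"
    and card: "card F1 = t + 1" "card F2 = t + 1" "card F3 = t + 1" "card D = t + 1"
    and F12: "card (F1 \<inter> F2) = t" and F3: "t \<le> card (F3 \<inter> F1)" "t \<le> card (F3 \<inter> F2)"
    and nsub: "\<not> F1 \<inter> F2 \<subseteq> F3"
    and D: "t \<le> card (D \<inter> F1)" "t \<le> card (D \<inter> F2)" "t \<le> card (D \<inter> F3)"
  shows "D \<subseteq> F1 \<union> F2"
proof (rule ccontr)
  assume nD: "\<not> D \<subseteq> F1 \<union> F2"
  have sub3: "F3 \<subseteq> F1 \<union> F2"
    using adjacent_both_cases[of F1 F2 F3 t] fin card F12 F3 nsub by auto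
  have WD: "F1 \<inter> F2 \<subseteq> D"
    using adjacent_both_cases[of F1 F2 D t] fin card F12 D nD by auto
  have "card (F1 \<inter> F3) < card F3"
  proof (intro psubset_card_mono psubsetI)
    show "F1 \<inter> F3 \<noteq> F3"
    proof
      assume "F1 \<inter> F3 = F3"
      then have "F3 = F1" using fin card by (intro card_seteq) auto
      then show False using nsub by auto
    qed
  qed (use fin in auto)
  then have "card (F1 \<inter> F3) \<le> t" using card by simp
  then have VD: "F1 \<inter> F3 \<subseteq> D"
    using adjacent_both_cases[of F1 F3 D t] fin card D nD sub3 by auto
  have "\<not> F1 \<inter> F3 \<subseteq> F1 \<inter> F2"
  proof
    assume "F1 \<inter> F3 \<subseteq> F1 \<inter> F2"
    then have "F1 \<inter> F3 = F1 \<inter> F2"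
      using fin F12 F3 by (intro card_seteq) (auto simp: Int_commute)
    then show False using nsub by auto
  qed
  then have "F1 \<inter> F2 \<subset> F1 \<inter> F2 \<union> F1 \<inter> F3" by auto
  then have "t < card (F1 \<inter> F2 \<union> F1 \<inter> F3)"
    using fin F12 by (metis finite_Int finite_Un psubset_card_mono)
  then have "F1 \<inter> F2 \<union> F1 \<inter> F3 = F1" using fin card by (intro card_seteq) auto
  then have "F1 \<subseteq> D" using WD VD by auto
  then have "F1 = D" using fin card by (intro card_seteq) auto
  then show False using nD by auto
qed

text \<open>Inclusion-exclusion inside \<open>D\<close> gives 2t \<le> (t + 1) + |D \<inter> I| with
  |I| \<le> t - 1, so equality holds throughout. Hence \<open>D\<close> is \<open>I\<close> plus one
  point from each of \<open>F1 - I\<close> and \<open>F2 - I\<close>, two sets of size 2.\<close>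

lemma card_adjacent_to_nonadjacent:
  assumes "finite F1" "finite F2" "card F1 = t + 1" "card F2 = t + 1" "card (F1 \<inter> F2) < t"
    and "\<A> \<subseteq> {D. finite D \<and> card D = t + 1 \<and> t \<le> card (D \<inter> F1) \<and> t \<le> card (D \<inter> F2)}"
  shows "card \<A> \<le> 4"
proof -
  define I where "I = F1 \<inter> F2"
  have main: "card I + 1 = t \<and> D \<in> (\<lambda>(a, b). insert a (insert b I)) ` ((F1 - I) \<times> (F2 - I))"
    if "D \<in> \<A>" for D
  proof -
    from that assms have D: "finite D" "card D = t + 1" "t \<le> card (D \<inter> F1)" "t \<le> card (D \<inter> F2)"
      by auto
    have "card (D \<inter> F1) + card (D \<inter> F2) = card (D \<inter> F1 \<union> D \<inter> F2) + card (D \<inter> I)"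
      using D card_Un_Int[of "D \<inter> F1" "D \<inter> F2"] by (simp add: I_def Int_ac)
    moreover have "card (D \<inter> F1 \<union> D \<inter> F2) \<le> t + 1"
      using D by (metis card_mono Int_lower1 Un_least)
    moreover have "card (D \<inter> I) \<le> card I" using assms by (intro card_mono) (auto simp: I_def)
    moreover have "card I < t" using assms by (simp add: I_def)
    ultimately have eq: "card I + 1 = t" "card (D \<inter> I) = card I"
      "card (D \<inter> F1 \<union> D \<inter> F2) = t + 1" "card (D \<inter> F1) = t" "card (D \<inter> F2) = t"
      using D by linarith+
    have fI: "finite I" using assms by (auto simp: I_def)
    have "D \<inter> I = I" using eq fI by (intro card_seteq) auto
    then have ID: "I \<subseteq> D" by auto
    have "D \<inter> F1 \<union> D \<inter> F2 = D" using D eq by (intro card_seteq) auto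
    then have DU: "D \<subseteq> F1 \<union> F2" by auto
    have "card (D \<inter> F1 - I) = 1" "card (D \<inter> F2 - I) = 1"
      using eq ID fI by (subst card_Diff_subset; auto simp: I_def)+
    then obtain a b where ab: "D \<inter> F1 - I = {a}" "D \<inter> F2 - I = {b}"
      by (auto simp: card_1_singleton_iff)
    then have "D = insert a (insert b I)" "(a, b) \<in> (F1 - I) \<times> (F2 - I)" using ID DU by auto
    then show ?thesis using eq by (auto intro!: image_eqI[of _ _ "(a, b)"])
  qed
  show ?thesis
  \<comment> \<open>The equality |I| = t - 1, which makes both differences 2-element sets, is only
    available once a common neighbour exists.\<close>
  proof (cases "\<A> = {}")
    case False
    then have c: "card I + 1 = t" using main by blast
    have "\<A> \<subseteq> (\<lambda>(a, b). insert a (insert b I)) ` ((F1 - I) \<times> (F2 - I))" using main by blast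
    then have "card \<A> \<le> card ((F1 - I) \<times> (F2 - I))"
      using assms by (intro surj_card_le) auto
    also have "\<dots> = 2 * 2"
      using assms c unfolding card_cartesian_product
      by (intro arg_cong2[of _ _ _ _ "(*)"]; subst card_Diff_subset; simp add: I_def)
    also have "\<dots> = 4" by simp
    finally show ?thesis .
  next
    case True
    then show ?thesis by (metis card.empty zero_le)
  qed
qed

section \<open>Sets that miss part of the centre of a star\<close>

text \<open>Since \<open>G\<close> meets \<open>W\<close> in fewer than \<open>t\<close> points,
  only \<open>z\<close> can raise the intersection to \<open>t\<close>. So \<open>z\<close> lies in
  \<open>G\<close> and the count is tight.\<close>

lemma card_insert_Int_notin:
  assumes "finite W" "card W = t" "card G = t + 1" "finite G" "\<not> W \<subseteq> G" "t \<le> card (G \<inter> insert z W)"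
  shows "z \<in> G - W" "card (G \<inter> W) + 1 = t" "card (G - W) = 2"
proof -
  have lt: "card (G \<inter> W) < t"
    using assms by (metis Int_lower2 inf.absorb_iff2 psubsetI psubset_card_mono)
  have z: "z \<in> G - W"
  proof (rule ccontr)
    assume "z \<notin> G - W"
    then have "G \<inter> insert z W = G \<inter> W" by auto
    then show False using lt assms by simp
  qed
  then have "G \<inter> insert z W = insert z (G \<inter> W)" by auto
  then have "card (G \<inter> insert z W) = card (G \<inter> W) + 1" using z assms by simp
  then show "card (G \<inter> W) + 1 = t" using lt assms by simp
  then show "card (G - W) = 2" using assms by (simp add: card_Diff_subset_Int)
  show "z \<in> G - W" by fact
qed

text \<open>A member \<open>insert z W\<close> of the star can be adjacent to \<open>G\<close> only
  if \<open>z\<close> is in \<open>G - W\<close>, and this set has two points as soon as one such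
  member exists.\<close>

lemma card_star_adjacent_le_2:
  assumes "finite W" "card W = t" "card G = t + 1" "finite G" "\<not> W \<subseteq> G"
    and "\<F> \<subseteq> H1 X W (t + 1)" "W \<subseteq> X"
  shows "card {F \<in> \<F>. t_intersecting t G F} \<le> 2"
proof (cases "{F \<in> \<F>. t_intersecting t G F} = {}")
  case False
  have sub: "\<F> \<subseteq> (\<lambda>x. insert x W) ` (X - W)"
    using assms H1_eq_image by metis
  then obtain z where "t \<le> card (G \<inter> insert z W)"
    using False by (auto simp: t_intersecting_def)
  then have c: "card (G - W) = 2" using card_insert_Int_notin assms by metis
  have "{F \<in> \<F>. t_intersecting t G F} \<subseteq> (\<lambda>x. insert x W) ` (G - W)"
  proof
    fix F assume F: "F \<in> {F \<in> \<F>. t_intersecting t G F}"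
    then obtain z where z: "F = insert z W" using sub by blast
    then have "z \<in> G - W"
      using F by (intro card_insert_Int_notin(1)[OF assms(1-5)]) (simp add: t_intersecting_def)
    then show "F \<in> (\<lambda>x. insert x W) ` (G - W)" using z by blast
  qed
  then have "card {F \<in> \<F>. t_intersecting t G F} \<le> card (G - W)"
    using assms by (intro surj_card_le) auto
  then show ?thesis using c by simp
next
  case True
  then show ?thesis by (metis card.empty zero_le)
qed

section \<open>Structure of a pair with a large second family\<close>

lemma card_le_common_adjacent:
  assumes "finite \<T>" "finite \<G>" "\<forall>F\<in>\<T>. card {G \<in> \<G>. t_disjoint t F G} \<le> s"
    and "card \<T> = c"
  shows "card \<G> \<le> card {G \<in> \<G>. \<forall>F\<in>\<T>. t_intersecting t F G} + c * s"
proof -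
  have "\<G> \<subseteq> {G \<in> \<G>. \<forall>F\<in>\<T>. t_intersecting t F G} \<union> (\<Union>F\<in>\<T>. {G \<in> \<G>. t_disjoint t F G})"
    by blast
  then have "card \<G> \<le> card ({G \<in> \<G>. \<forall>F\<in>\<T>. t_intersecting t F G} \<union>
      (\<Union>F\<in>\<T>. {G \<in> \<G>. t_disjoint t F G}))"
    using assms by (intro card_mono) auto
  also have "\<dots> \<le> card {G \<in> \<G>. \<forall>F\<in>\<T>. t_intersecting t F G} +
      card (\<Union>F\<in>\<T>. {G \<in> \<G>. t_disjoint t F G})"
    by (rule card_Un_le)
  also have "card (\<Union>F\<in>\<T>. {G \<in> \<G>. t_disjoint t F G}) \<le>
      (\<Sum>F\<in>\<T>. card {G \<in> \<G>. t_disjoint t F G})"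
    using assms by (intro card_UN_le)
  also have "\<dots> \<le> card \<T> * s"
    using sum_bounded_above[of \<T> "\<lambda>F. card {G \<in> \<G>. t_disjoint t F G}" s] assms by simp
  finally show ?thesis using assms by simp
qed

lemma obtain_two_elements:
  assumes "2 \<le> card A"
  obtains x y where "x \<in> A" "y \<in> A" "x \<noteq> y"
proof -
  obtain T where "T \<subseteq> A" "card T = 2" using obtain_subset_with_card_n[OF assms] by blast
  then show thesis using that by (auto simp: card_2_iff)
qed

text \<open>If \<open>\<G>\<close> is large, any two members of \<open>\<F>\<close> are adjacent,
  since a non-adjacent pair would leave only 4 + 2s members in \<open>\<G>\<close>. Two members then
  determine the centre, and a third one that misses it would again make \<open>\<G>\<close>
  small.\<close>

lemma star_or_small:
  assumes X: "finite X" and \<F>: "\<F> \<subseteq> nsets X (t + 1)" and \<G>: "\<G> \<subseteq> nsets X (t + 1)"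
    and disj: "\<And>F. F \<in> \<F> \<Longrightarrow> card {G \<in> \<G>. t_disjoint t F G} \<le> s"
    and "2 \<le> card \<F>" "0 < t" "0 < s"
  shows "(\<exists>W. card W = t \<and> W \<subseteq> X \<and> \<F> \<subseteq> H1 X W (t + 1)) \<or> card \<G> \<le> t + 2 + 3 * s"
proof (rule disjCI)
  assume large: "\<not> card \<G> \<le> t + 2 + 3 * s"
  have fin\<G>: "finite \<G>" using X \<G> by (meson finite_imp_finite_nsets finite_subset)
  have mem: "F \<subseteq> X" "finite F" "card F = t + 1" if "F \<in> \<F>" for F
    using that \<F> unfolding nsets_def by blast+
  have memG: "G \<subseteq> X" "finite G" "card G = t + 1" if "G \<in> \<G>" for G
    using that \<G> unfolding nsets_def by blast+
  have adj: "t \<le> card (F1 \<inter> F2)" if F12: "F1 \<in> \<F>" "F2 \<in> \<F>" for F1 F2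
  proof (rule ccontr)
    assume na: "\<not> t \<le> card (F1 \<inter> F2)"
    note m = mem[OF F12(1)] mem[OF F12(2)]
    have ne: "F1 \<noteq> F2" using na m by auto
    have "card \<G> \<le> card {G \<in> \<G>. \<forall>F\<in>{F1, F2}. t_intersecting t F G} + 2 * s"
      using disj F12 fin\<G> ne by (intro card_le_common_adjacent) auto
    moreover have "card {G \<in> \<G>. \<forall>F\<in>{F1, F2}. t_intersecting t F G} \<le> 4"
    proof (rule card_adjacent_to_nonadjacent)
      show "{G \<in> \<G>. \<forall>F\<in>{F1, F2}. t_intersecting t F G} \<subseteq>
          {D. finite D \<and> card D = t + 1 \<and> t \<le> card (D \<inter> F1) \<and> t \<le> card (D \<inter> F2)}"
        using memG by (simp add: t_intersecting_def Int_commute subset_iff)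
    qed (use m na in auto)
    \<comment> \<open>Here 4 + 2s \<le> t + 2 + 3s because \<open>t\<close> and \<open>s\<close> are
      both positive.\<close>
    ultimately show False using large assms by linarith
  qed
  obtain F1 F2 where F12: "F1 \<in> \<F>" "F2 \<in> \<F>" "F1 \<noteq> F2"
    using obtain_two_elements[OF \<open>2 \<le> card \<F>\<close>] .
  note m = mem[OF F12(1)] mem[OF F12(2)]
  have "card (F1 \<inter> F2) < card F1"
  proof (intro psubset_card_mono psubsetI)
    show "F1 \<inter> F2 \<noteq> F1"
      using F12 m card_subset_eq[of F2 F1] by (metis inf.absorb_iff1)
  qed (use m in auto)
  then have W: "card (F1 \<inter> F2) = t" using adj[OF F12(1,2)] m by simp
  have "F1 \<inter> F2 \<subseteq> F3" if F3: "F3 \<in> \<F>" for F3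
  proof (rule ccontr)
    assume nsub: "\<not> F1 \<inter> F2 \<subseteq> F3"
    note m3 = mem[OF F3]
    have "F1 \<noteq> F3" "F2 \<noteq> F3" using nsub by blast+
    then have c3: "card {F1, F2, F3} = 3" using F12 by simp
    \<comment> \<open>The common neighbours are \<open>(t + 1)\<close>-subsets of
      \<open>F1 \<union> F2\<close>, which has \<open>t + 2\<close> points.\<close>
    have "{G \<in> \<G>. \<forall>F\<in>{F1, F2, F3}. t_intersecting t F G} \<subseteq> nsets (F1 \<union> F2) (t + 1)"
    proof
      fix D assume D: "D \<in> {G \<in> \<G>. \<forall>F\<in>{F1, F2, F3}. t_intersecting t F G}"
      then have D': "finite D" "card D = t + 1" using memG by auto
      have "t \<le> card (D \<inter> F1)" "t \<le> card (D \<inter> F2)" "t \<le> card (D \<inter> F3)"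
        using D by (auto simp: t_intersecting_def Int_commute)
      then have "D \<subseteq> F1 \<union> F2"
        using adjacent_triple_subset[of F1 F2 F3 D t] m m3 D' W nsub adj[OF F3 F12(1)] adj[OF F3 F12(2)]
        by blast
      then show "D \<in> nsets (F1 \<union> F2) (t + 1)" using D' by (simp add: mem_nsets)
    qed
    then have "card {G \<in> \<G>. \<forall>F\<in>{F1, F2, F3}. t_intersecting t F G} \<le> card (nsets (F1 \<union> F2) (t + 1))"
      using m by (intro card_mono finite_imp_finite_nsets) auto
    also have "card (F1 \<union> F2) = Suc (t + 1)"
      using card_Un_Int[of F1 F2] W m by simp
    then have "card (nsets (F1 \<union> F2) (t + 1)) = Suc (t + 1)"
      using m by (intro card_nsets_Suc) auto
    finally have "card {G \<in> \<G>. \<forall>F\<in>{F1, F2, F3}. t_intersecting t F G} \<le> t + 2" by simp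
    moreover have "card \<G> \<le> card {G \<in> \<G>. \<forall>F\<in>{F1, F2, F3}. t_intersecting t F G} + 3 * s"
      using disj F12 F3 fin\<G> c3 by (intro card_le_common_adjacent) auto
    ultimately show False using large by linarith
  qed
  then have "\<F> \<subseteq> H1 X (F1 \<inter> F2) (t + 1)" using \<F> by (auto simp: H1_def)
  then show "\<exists>W. card W = t \<and> W \<subseteq> X \<and> \<F> \<subseteq> H1 X W (t + 1)"
    using W m by (intro exI[of _ "F1 \<inter> F2"]) auto
qed

text \<open>The last two claims rest on one fact: a member of \<open>\<D>\<close> is adjacent to at
  most two members of the star, hence \<open>t\<close>-disjoint with all the others. The product
  inequality counts the \<open>t\<close>-disjoint pairs in \<F> x \<D> from both sides.\<close>

lemma star_bounds:
  assumes X: "finite X" and W: "card W = t" "W \<subseteq> X"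
    and \<F>: "\<F> \<subseteq> H1 X W (t + 1)" and \<G>: "\<G> \<subseteq> nsets X (t + 1)"
    and disj: "almost_cross_intersecting s t \<F> \<G>"
  defines "\<D> \<equiv> {G \<in> \<G>. \<not> W \<subseteq> G}"
  shows "card \<G> = card (\<G> \<inter> H1 X W (t + 1)) + card \<D>"
    and "\<D> \<noteq> {} \<Longrightarrow> card \<F> \<le> s + 2"
    and "(card \<F> - 2) * card \<D> \<le> card \<F> * s"
proof -
  have finW: "finite W" using X W finite_subset by blast
  have fin\<G>: "finite \<G>" using X \<G> by (meson finite_imp_finite_nsets finite_subset)
  have fin\<F>: "finite \<F>"
    using X \<F> by (metis (no_types, lifting) H1_def finite_imp_finite_nsets finite_subset mem_Collect_eq subsetI)
  have "\<G> = \<G> \<inter> H1 X W (t + 1) \<union> \<D>" using \<G> by (auto simp: \<D>_def H1_def)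
  moreover have "\<G> \<inter> H1 X W (t + 1) \<inter> \<D> = {}" by (auto simp: \<D>_def H1_def)
  ultimately show "card \<G> = card (\<G> \<inter> H1 X W (t + 1)) + card \<D>"
    using fin\<G> by (metis card_Un_disjoint finite_Un)
  have ge: "card \<F> - 2 \<le> card {F \<in> \<F>. t_disjoint t G F}" if "G \<in> \<D>" for G
  proof -
    have "card {F \<in> \<F>. t_intersecting t G F} \<le> 2"
      using that \<G> finW W \<F> by (intro card_star_adjacent_le_2[of W t G \<F> X]) (auto simp: \<D>_def mem_nsets)
    moreover have "card \<F> = card {F \<in> \<F>. t_intersecting t G F} + card {F \<in> \<F>. t_disjoint t G F}"
      using fin\<F> by (subst card_Un_disjoint[symmetric]) (auto intro: arg_cong[of _ _ card])
    ultimately show ?thesis by simp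
  qed
  show "card \<F> \<le> s + 2" if ne: "\<D> \<noteq> {}"
  proof -
    obtain G where "G \<in> \<D>" using ne by blast
    then have "card \<F> - 2 \<le> s"
      using ge[of G] disj unfolding almost_cross_intersecting_def \<D>_def by fastforce
    then show ?thesis by simp
  qed
  have "(card \<F> - 2) * card \<D> \<le> (\<Sum>G\<in>\<D>. card {F \<in> \<F>. t_disjoint t G F})"
    using sum_bounded_below[of \<D> "card \<F> - 2" "\<lambda>G. card {F \<in> \<F>. t_disjoint t G F}"] ge
    by (simp add: mult.commute)
  also have "\<dots> = (\<Sum>F\<in>\<F>. card {G \<in> \<D>. t_disjoint t G F})"
    using fin\<F> fin\<G> by (intro sum_multicount_gen) (auto simp: \<D>_def)
  also have "\<dots> \<le> card \<F> * s"
  proof -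
    have "card {G \<in> \<D>. t_disjoint t G F} \<le> s" if "F \<in> \<F>" for F
    proof -
      have "card {G \<in> \<D>. t_disjoint t G F} \<le> card {G \<in> \<G>. t_disjoint t F G}"
        using fin\<G> by (intro card_mono) (auto simp: \<D>_def t_intersecting_def Int_commute)
      then show ?thesis using disj that by (force simp: almost_cross_intersecting_def)
    qed
    then show ?thesis
      using sum_bounded_above[of \<F> "\<lambda>F. card {G \<in> \<D>. t_disjoint t G F}" s] by simp
  qed
  finally show "(card \<F> - 2) * card \<D> \<le> card \<F> * s" .
qed

text \<open>The double count in \<open>star_bounds\<close> is void when \<open>\<F>\<close> has just
  two members, so this case needs its own bound. Apart from at most 2s exceptions, a set counted
  here is adjacent to both \<open>F1\<close> and \<open>F2\<close> without containing their
  intersection \<open>W\<close>, so it lies in the \<open>(t + 2)\<close>-set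
  \<open>F1 \<union> F2\<close>.\<close>

lemma card_pair_star:
  assumes X: "finite X" and W: "card W = t" "W \<subseteq> X"
    and \<F>: "\<F> \<subseteq> H1 X W (t + 1)" and \<G>: "\<G> \<subseteq> nsets X (t + 1)"
    and disj: "almost_cross_intersecting s t \<F> \<G>" and "2 \<le> card \<F>"
  shows "card {G \<in> \<G>. \<not> W \<subseteq> G} \<le> t + 2 + 2 * s"
proof -
  have fin\<G>: "finite \<G>" using X \<G> by (meson finite_imp_finite_nsets finite_subset)
  have finW: "finite W" using X W finite_subset by blast
  obtain F1 F2 where F12: "F1 \<in> \<F>" "F2 \<in> \<F>" "F1 \<noteq> F2"
    using obtain_two_elements[OF \<open>2 \<le> card \<F>\<close>] .
  have "\<exists>x. F = insert x W \<and> x \<notin> W" if "F \<in> \<F>" for F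
  proof -
    have "F \<in> (\<lambda>x. insert x W) ` (X - W)" using that \<F> H1_eq_image[OF finW W] by blast
    then show ?thesis by blast
  qed
  then obtain x y where xy: "F1 = insert x W" "F2 = insert y W" "x \<notin> W" "y \<notin> W"
    using F12(1,2) by meson
  let ?\<D> = "{G \<in> \<G>. \<not> W \<subseteq> G}"
  have "{G \<in> ?\<D>. \<forall>F\<in>{F1, F2}. t_intersecting t F G} \<subseteq> nsets (insert x (insert y W)) (t + 1)"
  proof
    fix D assume D: "D \<in> {G \<in> ?\<D>. \<forall>F\<in>{F1, F2}. t_intersecting t F G}"
    then have D': "finite D" "card D = t + 1" using \<G> by (auto simp: mem_nsets)
    have I: "F1 \<inter> F2 = W" using xy F12 by auto
    have "t \<le> card (D \<inter> F1)" "t \<le> card (D \<inter> F2)"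
      using D by (auto simp: t_intersecting_def Int_commute)
    then have "F1 \<inter> F2 \<subseteq> D \<or> D \<subseteq> F1 \<union> F2"
      using D' I xy finW W by (intro adjacent_both_cases) auto
    then have "D \<subseteq> F1 \<union> F2" using D I by auto
    then show "D \<in> nsets (insert x (insert y W)) (t + 1)"
      using D' xy by (auto simp: mem_nsets)
  qed
  then have "card {G \<in> ?\<D>. \<forall>F\<in>{F1, F2}. t_intersecting t F G} \<le> card (nsets (insert x (insert y W)) (t + 1))"
    using finW by (intro card_mono finite_imp_finite_nsets) auto
  also have "\<dots> = Suc (t + 1)"
    using finW W xy F12 by (intro card_nsets_Suc) auto
  finally have "card {G \<in> ?\<D>. \<forall>F\<in>{F1, F2}. t_intersecting t F G} \<le> t + 2" by simp
  moreover have "card {G \<in> ?\<D>. t_disjoint t F G} \<le> s" if "F \<in> \<F>" for F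
  proof -
    have "card {G \<in> ?\<D>. t_disjoint t F G} \<le> card {G \<in> \<G>. t_disjoint t F G}"
      using fin\<G> by (intro card_mono) auto
    then show ?thesis using disj that by (force simp: almost_cross_intersecting_def)
  qed
  then have "card ?\<D> \<le> card {G \<in> ?\<D>. \<forall>F\<in>{F1, F2}. t_intersecting t F G} + 2 * s"
    using F12 fin\<G> by (intro card_le_common_adjacent) auto
  ultimately show ?thesis by linarith
qed

section \<open>The two extremal examples, which bound the maximum product from below\<close>

lemma exists_nonadjacent_family:
  assumes Y: "Y \<in> nsets {1..n} (t + 1)" and "0 < t" "2 * t + 1 + s \<le> n"
  obtains \<C> where "\<C> \<subseteq> nsets {1..n} (t + 1) - M1 n Y (t + 1) t" "card \<C> = s"
proof -
  have Y': "Y \<subseteq> {1..n}" "finite Y" "card Y = t + 1" using Y by (auto simp: mem_nsets)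
  have c: "card ({1..n} - Y) = n - t - 1" using Y' by (simp add: card_Diff_subset)
  then have "t \<le> card ({1..n} - Y)" using assms by simp
  \<comment> \<open>Sets outside \<open>Y\<close> through a fixed \<open>t\<close>-set
    \<open>T\<close> are disjoint from \<open>Y\<close>, and there are n - 2t - 1 of them, enough to
    choose \<open>s\<close>.\<close>
  then obtain T where T: "T \<subseteq> {1..n} - Y" "card T = t" "finite T"
    using obtain_subset_with_card_n by metis
  have "card (H1 ({1..n} - Y) T (t + 1)) = n - t - 1 - t"
    using card_H1[of "{1..n} - Y" T t] T c by simp
  then have "s \<le> card (H1 ({1..n} - Y) T (t + 1))" using assms by simp
  then obtain \<C> where \<C>: "\<C> \<subseteq> H1 ({1..n} - Y) T (t + 1)" "card \<C> = s"
    using obtain_subset_with_card_n by metis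
  have "G \<in> nsets {1..n} (t + 1) - M1 n Y (t + 1) t" if "G \<in> \<C>" for G
  proof -
    have G: "G \<subseteq> {1..n} - Y" "G \<in> nsets {1..n} (t + 1)"
      using that \<C> unfolding H1_def nsets_def by blast+
    then have "G \<inter> Y = {}" by blast
    then show ?thesis using G \<open>0 < t\<close> by (simp add: M1_def)
  qed
  then show thesis using that \<C> by blast
qed

lemma admissible_ball:
  assumes Y: "Y \<in> nsets {1..n} (t + 1)" and \<C>: "\<C> \<subseteq> nsets {1..n} (t + 1) - M1 n Y (t + 1) t"
    and "card \<C> = s" "0 < s"
  shows "admissible_pair n t s {Y} (M1 n Y (t + 1) t \<union> \<C>)"
    and "card (M1 n Y (t + 1) t \<union> \<C>) = card (M1 n Y (t + 1) t) + s"
proof -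
  have fin: "finite \<C>" "finite (M1 n Y (t + 1) t)" using assms finite_M1 card_ge_0_finite by auto
  have M1: "M1 n Y (t + 1) t \<subseteq> nsets {1..n} (t + 1)" by (auto simp: M1_def)
  show card: "card (M1 n Y (t + 1) t \<union> \<C>) = card (M1 n Y (t + 1) t) + s"
    using fin assms by (subst card_Un_disjoint) auto
  have nM1: "t_disjoint t Y G" if "G \<in> \<C>" for G
    using that \<C> by (auto simp: M1_def t_intersecting_def Int_commute)
  have "{G \<in> M1 n Y (t + 1) t \<union> \<C>. t_disjoint t Y G} \<subseteq> \<C>"
    by (auto simp: M1_def t_intersecting_def Int_commute)
  then have "card {G \<in> M1 n Y (t + 1) t \<union> \<C>. t_disjoint t Y G} \<le> s"
    using fin \<open>card \<C> = s\<close> card_mono by blast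
  moreover have "card {F \<in> {Y}. t_disjoint t G F} \<le> s" for G
    using card_mono[of "{Y}" "{F \<in> {Y}. t_disjoint t G F}"] \<open>0 < s\<close> by force
  moreover have "\<C> \<noteq> {}" using assms by auto
  then have "\<exists>G \<in> M1 n Y (t + 1) t \<union> \<C>. t_disjoint t Y G" using nM1 by blast
  ultimately show "admissible_pair n t s {Y} (M1 n Y (t + 1) t \<union> \<C>)"
    using Y M1 \<C> card assms
    unfolding admissible_pair_def almost_cross_intersecting_def cross_intersecting_def by auto
qed

text \<open>The members of \<open>\<D>\<close> below are \<open>{2..t}\<close> joined to the edges of a cycle on \<open>{t + 1..t + s + 2}\<close>.\<close>

lemma exists_admissible_star:
  assumes "0 < t" "0 < s" "t + s + 2 \<le> n"
  obtains \<F> \<G> where "admissible_pair n t s \<F> \<G>" "card \<F> = s + 2" "card \<G> = (n - t) + (s + 2)"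
proof -
  define W Z where "W = {1..t}" and "Z = {1..t + s + 2}"
  define e where "e i = {2..t} \<union> {t + 1 + i, if i = s + 1 then t + 1 else t + 2 + i}" for i
  define \<F> \<D> where "\<F> = H1 Z W (t + 1)" and "\<D> = e ` {..<s + 2}"
  define \<S> where "\<S> = H1 {1..n} W (t + 1)"
  have W: "finite W" "card W = t" "W \<subseteq> Z" "W \<subseteq> {1..n}" "Z \<subseteq> {1..n}" and Z: "finite Z" "card Z = t + s + 2"
    using assms by (auto simp: W_def Z_def)
  have \<F>: "\<F> = (\<lambda>x. insert x W) ` (Z - W)" unfolding \<F>_def by (rule H1_eq_image) (use W in auto)
  have card\<F>: "card \<F> = s + 2" unfolding \<F>_def using card_H1[of Z W t] W Z by simp
  have card\<S>: "card \<S> = n - t" unfolding \<S>_def using card_H1[of "{1..n}" W t] W by simp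
  have \<F>\<S>: "\<F> \<subseteq> \<S>" using W unfolding \<F>_def \<S>_def H1_def nsets_def by blast
  have e: "card (e i) = t + 1" "e i \<subseteq> Z" "1 \<notin> e i" "finite (e i)" if "i < s + 2" for i
    using that assms by (auto simp: e_def Z_def card_insert_if)
  \<comment> \<open>The cycle has length \<open>s + 2\<close>, at least 3 because \<open>s\<close>
    is positive; a cycle of length 2 would repeat its edge.\<close>
  have inj: "inj_on e {..<s + 2}"
  proof (rule inj_onI)
    fix i j assume ij: "i \<in> {..<s + 2}" "j \<in> {..<s + 2}" "e i = e j"
    have *: "e i - {2..t} = {t + 1 + i, if i = s + 1 then t + 1 else t + 2 + i}" for i
      by (auto simp: e_def)
    have "{t + 1 + i, if i = s + 1 then t + 1 else t + 2 + i} =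
        {t + 1 + j, if j = s + 1 then t + 1 else t + 2 + j}"
      using ij(3) *[of i] *[of j] by simp
    then show "i = j" using ij(1,2) \<open>0 < s\<close> by (auto simp: doubleton_eq_iff split: if_splits)
  qed
  have card\<D>: "card \<D> = s + 2" unfolding \<D>_def using inj by (simp add: card_image)
  have fin: "finite \<D>" "finite \<S>" "finite \<F>"
    using card\<S> card\<F> finite_subset[OF \<F>\<S>] unfolding \<D>_def \<S>_def
    by (auto simp: H1_def finite_imp_finite_nsets)
  have "1 \<in> G" if "G \<in> \<S>" for G
    using that \<open>0 < t\<close> unfolding \<S>_def H1_def W_def by fastforce
  then have \<D>\<S>: "\<D> \<inter> \<S> = {}" using e(3) unfolding \<D>_def by blast
  have meet: "t_intersecting t (insert z W) (e i)" if "z \<in> e i" "z \<notin> W" "i < s + 2" for z i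
  proof -
    have "insert z {2..t} \<subseteq> insert z W \<inter> e i" using that by (auto simp: W_def e_def)
    then have "card (insert z {2..t}) \<le> card (insert z W \<inter> e i)" using W by (intro card_mono) auto
    moreover have "card (insert z {2..t}) = t" using that assms by (auto simp: W_def card_insert_if)
    ultimately show ?thesis by (simp add: t_intersecting_def)
  qed
  have star: "t_intersecting t F G" if "F \<in> \<F>" "G \<in> \<S>" for F G
  proof -
    have "W \<subseteq> F \<inter> G" "finite (F \<inter> G)" using that by (auto simp: \<F>_def \<S>_def H1_def mem_nsets)
    then have "card W \<le> card (F \<inter> G)" by (rule card_mono[rotated])
    then show ?thesis using W by (simp add: t_intersecting_def)
  qed
  \<comment> \<open>Used in both directions: a member of \<open>\<F>\<close> is adjacent to the two
    edges at its vertex, and a member of \<open>\<D>\<close> to the two stars' sets at its end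
    points, which leaves at most \<open>s\<close> of \<open>s + 2\<close>.\<close>
  have diff2: "card B \<le> s" if "finite A" "card A = s + 2" "a \<in> A" "b \<in> A" "a \<noteq> b" "B \<subseteq> A - {a, b}"
    for A B :: "nat set set" and a b
  proof -
    have "card B \<le> card (A - {a, b})" using that by (intro card_mono) auto
    also have "\<dots> = s" using that by (subst card_Diff_subset) auto
    finally show ?thesis .
  qed
  have disjF: "card {G \<in> \<S> \<union> \<D>. t_disjoint t F G} \<le> s" if F: "F \<in> \<F>" for F
  proof -
    obtain z where z: "F = insert z W" "z \<in> Z - W" using F \<F> by blast
    \<comment> \<open>The edges at \<open>z\<close> are the one starting there and its predecessor,
      with wrap-around at the first vertex.\<close>
    define i j where "i = z - (t + 1)" and "j = (if i = 0 then s + 1 else i - 1)"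
    have ij: "i < s + 2" "j < s + 2" "i \<noteq> j" "z = t + 1 + i"
      using z(2) \<open>0 < s\<close> by (auto simp: i_def j_def Z_def W_def)
    have "z \<in> e i" "z \<in> e j" using ij by (auto simp: e_def j_def)
    then have "t_intersecting t F (e i)" "t_intersecting t F (e j)" using meet z ij by auto
    moreover have "e i \<in> \<D>" "e j \<in> \<D>" "e i \<noteq> e j"
      using ij inj by (auto simp: \<D>_def inj_on_eq_iff)
    ultimately show ?thesis
      using star[OF F] by (intro diff2[of \<D> "e i" "e j"] fin card\<D>) auto
  qed
  have disjG: "card {F \<in> \<F>. t_disjoint t G F} \<le> s" if G: "G \<in> \<S> \<union> \<D>" for G
  proof (cases "G \<in> \<S>")
    case True
    then have "{F \<in> \<F>. t_disjoint t G F} = {}" using star by (auto simp: t_intersecting_def Int_commute)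
    then show ?thesis by (simp only: card.empty)
  next
    case False
    then obtain i where i: "i < s + 2" "G = e i" using G by (auto simp: \<D>_def)
    define x y where "x = t + 1 + i" and "y = (if i = s + 1 then t + 1 else t + 2 + i)"
    have xy: "x \<in> e i" "y \<in> e i" "x \<noteq> y" "x \<in> Z - W" "y \<in> Z - W"
      using i by (auto simp: x_def y_def e_def Z_def W_def)
    then have "t_intersecting t G (insert x W)" "t_intersecting t G (insert y W)"
      using meet[of x i] meet[of y i] i by (auto simp: t_intersecting_def Int_commute)
    moreover have "insert x W \<in> \<F>" "insert y W \<in> \<F>" "insert x W \<noteq> insert y W"
      using xy \<F> by auto
    ultimately show ?thesis by (intro diff2[of \<F> "insert x W" "insert y W"] fin card\<F>) auto
  qed
  \<comment> \<open>As \<open>s\<close> is positive, the edge of \<open>e 1\<close> is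
    \<open>{t + 2, t + 3}\<close> and avoids the vertex \<open>t + 1\<close>; the two sets share
    only \<open>{2..t}\<close>.\<close>
  have "\<not> t_intersecting t (insert (t + 1) W) (e 1)"
  proof -
    have "insert (t + 1) W \<inter> e 1 = {2..t}" using \<open>0 < s\<close> by (auto simp: W_def e_def)
    then show ?thesis using \<open>0 < t\<close> by (simp add: t_intersecting_def)
  qed
  moreover have "insert (t + 1) W \<in> \<F>" "e 1 \<in> \<D>"
    using \<F> by (auto simp: \<D>_def Z_def W_def)
  ultimately have "\<not> cross_intersecting t \<F> (\<S> \<union> \<D>)" by (auto simp: cross_intersecting_def)
  moreover have "card (\<S> \<union> \<D>) = (n - t) + (s + 2)"
    using \<D>\<S> fin card\<D> card\<S> by (subst card_Un_disjoint) auto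
  moreover have "\<F> \<subseteq> nsets {1..n} (t + 1)" "\<S> \<union> \<D> \<subseteq> nsets {1..n} (t + 1)"
    using \<F>\<S> e W by (auto simp: \<S>_def H1_def \<D>_def mem_nsets subset_iff)
  ultimately show thesis
    using that[of \<F> "\<S> \<union> \<D>"] disjF disjG card\<F>
    by (auto simp: admissible_pair_def almost_cross_intersecting_def)
qed

section \<open>Numerical comparison of the possible products\<close>

text \<open>Subtracting \<open>t\<close> costs at most one of the five copies of s (t + 1)^2. The
  remaining four give the claims through t + 1 \<ge> 2, s \<ge> 1 and, for t \<ge> 3, t + 1 \<ge>
  4.\<close>

lemma ground_set_bounds:
  fixes n t s :: nat
  assumes "0 < t" "0 < s" "5 * s * (t + 1)^2 \<le> n"
  shows "8 * (s * (t + 1)) \<le> n - t" "4 * (t + 1)^2 \<le> n - t" "3 \<le> t \<Longrightarrow> 16 * (s * (t + 1)) \<le> n - t"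
proof -
  define v where "v = s * (t + 1)"
  have n: "5 * (v * (t + 1)) \<le> n" using assms(3) by (simp add: v_def power2_eq_square algebra_simps)
  have "v * 2 \<le> v * (t + 1)" using assms by (intro mult_le_mono) auto
  moreover have vt: "t + 1 \<le> v" using mult_le_mono1[of 1 s "t + 1"] assms by (simp add: v_def)
  ultimately have n': "4 * (v * (t + 1)) \<le> n - t" using n by linarith
  then show "8 * (s * (t + 1)) \<le> n - t"
    using \<open>v * 2 \<le> v * (t + 1)\<close> unfolding v_def[symmetric] by linarith
  show "4 * (t + 1)^2 \<le> n - t"
    using n' mult_le_mono1[OF vt, of "t + 1"] by (simp add: power2_eq_square)
  show "16 * (s * (t + 1)) \<le> n - t" if "3 \<le> t"
  proof -
    have "v * 4 \<le> v * (t + 1)" using that by (intro mult_le_mono) auto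
    then show ?thesis using n' unfolding v_def[symmetric] by linarith
  qed
qed

text \<open>With \<open>q\<close> standing for \<open>n - t\<close>, \<open>L\<close> is the product
  of the ball example. The three values below it bound the product when \<open>\<G>\<close> is
  small, when \<open>\<F>\<close> is a star with two members, and when it is a star with m \<ge> 3
  members.\<close>

lemma below_ball_bound:
  fixes q t s :: nat
  assumes "s + 2 \<le> t" "0 < s" and q: "4 * (t + 1)^2 \<le> q" "16 * (s * (t + 1)) \<le> q"
  defines "L \<equiv> (t + 1) * (q - 1) + 1 + s"
  shows "(t + 2 + 3 * s)^2 < L" "2 * (q + t + 2 + 2 * s) < L"
    "m \<le> s + 2 \<Longrightarrow> m * q + s * (m + 6) < L"
proof -
  \<comment> \<open>In terms of \<open>r\<close> the hypotheses say s \<le> r and r \<ge> 1, hence t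
    + 2 + 3s \<le> 4(r + 1).\<close>
  define r where "r = t - 2"
  have r: "t = r + 2" "s \<le> r" "1 \<le> r" using assms by (auto simp: r_def)
  have "4 * (q - 1) \<le> (t + 1) * (q - 1)" using r by (intro mult_le_mono1) auto
  then have L4: "4 * q + s \<le> L + 3" unfolding L_def by linarith
  have sq: "(t + 1)^2 = (r + 1)^2 + 4 * r + 8" by (simp add: r power2_eq_square algebra_simps)
  have "(t + 2 + 3 * s)^2 \<le> (4 * (r + 1))^2" using r by (intro power_mono) auto
  also have "\<dots> = 16 * (r + 1)^2" by (simp add: power2_eq_square algebra_simps)
  also have "\<dots> < L" using L4 q(1) sq by linarith
  finally show "(t + 2 + 3 * s)^2 < L" .
  have "1 * (t + 1) \<le> s * (t + 1)" using assms by (intro mult_le_mono1) simp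
  then have "16 * (t + 1) \<le> 16 * (s * (t + 1))" by (intro mult_le_mono2) simp
  then have q16: "16 * t + 16 \<le> q" using q(2) by simp
  then show "2 * (q + t + 2 + 2 * s) < L" using L4 assms(1) by simp
  show "m * q + s * (m + 6) < L" if "m \<le> s + 2"
  proof -
    have "m * q \<le> t * q" "s * (m + 6) \<le> s * (t + 6)" using that assms by (intro mult_le_mono; simp)+
    moreover have "(t + 1) * (q - 1) + t + 1 = t * q + q"
      using q(2) assms(2) by (cases q) (simp_all add: algebra_simps)
    moreover have "s * (t + 6) = s * (t + 1) + 5 * s" by (simp add: algebra_simps)
    ultimately have "m * q + s * (m + 6) + q \<le> (t + 1) * (q - 1) + t + 1 + s * (t + 1) + 5 * s"
      by linarith
    moreover have "16 * (s * t) + 16 * s \<le> q" using q(2) by simp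
    moreover have "s * (t + 1) = s * t + s" by simp
    ultimately show ?thesis using q16 assms(1) unfolding L_def by linarith
  qed
qed

text \<open>Now \<open>L\<close> is the product of the star example, again with \<open>q\<close> for
  \<open>n - t\<close>. The third bound stops at m \<le> s + 1 because m = s + 2 is the extremal
  size; the fourth disposes of the ball.\<close>

lemma below_star_bound:
  fixes q t s :: nat
  assumes "t \<le> s + 1" "0 < s" "0 < t" and q: "8 * (s * (t + 1)) \<le> q"
  defines "L \<equiv> (s + 2) * (q + s + 2)"
  shows "(t + 2 + 3 * s)^2 < L" "2 * (q + t + 2 + 2 * s) < L"
    "m \<le> s + 1 \<Longrightarrow> m * q + s * (m + 6) < L" "(t + 1) * (q - 1) + 1 + s < L"
proof -
  have "2 * s \<le> s * (t + 1)" using \<open>0 < t\<close> by simp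
  then have q16: "16 * s \<le> q" using q by linarith
  have L: "L = s * q + 2 * q + s * s + 4 * s + 4" by (simp add: L_def algebra_simps)
  have sq: "16 * (s * s) \<le> s * q" using mult_le_mono2[OF q16, of s] by simp
  have "(t + 2 + 3 * s)^2 \<le> (4 * s + 3)^2" using assms by (intro power_mono) auto
  also have "\<dots> = 16 * (s * s) + 24 * s + 9" by (simp add: power2_eq_square algebra_simps)
  also have "\<dots> < L" using L sq q16 \<open>0 < s\<close> by linarith
  finally show "(t + 2 + 3 * s)^2 < L" .
  have "16 * s \<le> s * q" using sq le_square[of s] by linarith
  moreover have "2 * (q + t + 2 + 2 * s) \<le> 2 * q + 6 * s + 6" using assms(1) by simp
  ultimately show "2 * (q + t + 2 + 2 * s) < L" using L \<open>0 < s\<close> by linarith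
  show "m * q + s * (m + 6) < L" if "m \<le> s + 1"
  proof -
    have "m * q \<le> (s + 1) * q" "s * (m + 6) \<le> s * (s + 7)" using that by (intro mult_le_mono; simp)+
    moreover have "(s + 1) * q = s * q + q" "s * (s + 7) = s * s + 7 * s" by (simp_all add: algebra_simps)
    ultimately show ?thesis using L q16 by linarith
  qed
  have "(t + 1) * (q - 1) \<le> (s + 2) * q" using assms by (intro mult_le_mono) auto
  also have "\<dots> = s * q + 2 * q" by (simp add: algebra_simps)
  finally show "(t + 1) * (q - 1) + 1 + s < L" using L by linarith
qed

text \<open>Multiplying the hypothesis by \<open>m\<close> reduces the claim to m^2 \<le> (m - 2)(m
  + 6), that is, to 4m \<ge> 12.\<close>

lemma star_product_bound:
  fixes m d s :: nat
  assumes "3 \<le> m" "(m - 2) * d \<le> m * s"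
  shows "m * d \<le> s * (m + 6)"
proof -
  obtain k where k: "m = k + 3" using assms(1) by (metis le_Suc_ex add.commute)
  have "(k + 1) * (m * d) = m * ((m - 2) * d)" by (simp add: k algebra_simps)
  also have "\<dots> \<le> m * (m * s)" using assms(2) by (intro mult_le_mono2)
  also have "\<dots> \<le> (k + 1) * (s * (m + 6))" by (simp add: k algebra_simps)
  finally show ?thesis by (metis Suc_eq_plus1 Suc_mult_le_cancel1)
qed

section \<open>Recovering the extremal structure and concluding\<close>

text \<open>The double count gives |\<D>| \<le> s + 2, so the size of \<open>\<G>\<close> forces
  equality there and forces \<open>\<G>\<close> to contain the whole star. Regarding each
  \<open>D - W\<close> as an edge on \<open>S\<close>, every vertex has degree at least 2, and the
  number of edges equals the number of vertices.\<close>

lemma star_extremal: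
  assumes X: "finite X" and W: "card W = t" "W \<subseteq> X"
    and \<F>: "\<F> \<subseteq> H1 X W (t + 1)" and \<G>: "\<G> \<subseteq> nsets X (t + 1)"
    and disj: "almost_cross_intersecting s t \<F> \<G>" and "0 < s"
    and card\<F>: "card \<F> = s + 2" and card\<G>: "(card X - t) + (s + 2) \<le> card \<G>"
  shows "\<exists>Z \<in> nsets X (t + s + 2). \<exists>W \<in> nsets Z t. \<exists>\<D>.
    \<D> \<subseteq> M2 Z W t \<and> card \<D> = s + 2 \<and> (\<forall>z \<in> Z - W. card {D \<in> \<D>. z \<in> D} = 2) \<and>
    \<F> = H1 Z W (t + 1) \<and> \<G> = H1 X W (t + 1) \<union> \<D>"
proof -
  have finW: "finite W" using X W finite_subset by blast
  have fin\<G>: "finite \<G>" using X \<G> by (meson finite_imp_finite_nsets finite_subset)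
  have fin\<F>: "finite \<F>" using card\<F> card.infinite by fastforce
  have finH: "finite (H1 X W (t + 1))" using X by (simp add: H1_def finite_imp_finite_nsets)
  define \<D> where "\<D> = {G \<in> \<G>. \<not> W \<subseteq> G}"
  have fin\<D>: "finite \<D>" using fin\<G> by (simp add: \<D>_def)
  note star = star_bounds[OF X W \<F> \<G> disj, folded \<D>_def]
  have "s * card \<D> \<le> s * (s + 2)" using star(3) card\<F> by (simp add: mult.commute)
  then have "card \<D> \<le> s + 2" using \<open>0 < s\<close> mult_left_le_imp_le by blast
  moreover have "card (\<G> \<inter> H1 X W (t + 1)) \<le> card (H1 X W (t + 1))" using finH by (intro card_mono) auto
  moreover have "card (H1 X W (t + 1)) = card X - t" using card_H1 X W by blast
  ultimately have card\<D>: "card \<D> = s + 2"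
    and cardH: "card (\<G> \<inter> H1 X W (t + 1)) = card (H1 X W (t + 1))"
    using star(1) card\<G> by linarith+
  have "\<G> \<inter> H1 X W (t + 1) = H1 X W (t + 1)" using cardH finH by (intro card_subset_eq) auto
  moreover have "\<G> = \<G> \<inter> H1 X W (t + 1) \<union> \<D>" using \<G> by (auto simp: \<D>_def H1_def)
  ultimately have \<G>eq: "\<G> = H1 X W (t + 1) \<union> \<D>" by simp
  define S where "S = {x \<in> X - W. insert x W \<in> \<F>}"
  have S: "S \<subseteq> X" "S \<inter> W = {}" "finite S" using X by (auto simp: S_def)
  have \<F>S: "\<F> = (\<lambda>x. insert x W) ` S"
    using \<F> unfolding H1_eq_image[OF finW W] S_def by blast
  have inj: "inj_on (\<lambda>x. insert x W) S" using S(2) by (auto simp: inj_on_def)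
  have cardS: "card S = s + 2" using card\<F> \<F>S inj by (simp add: card_image)
  define Z where "Z = W \<union> S"
  have Z: "Z \<in> nsets X (t + s + 2)"
    using S W finW cardS by (auto simp: Z_def mem_nsets card_Un_disjoint Int_commute)
  have WZ: "W \<in> nsets Z t" using W finW by (simp add: Z_def mem_nsets)
  have ZW: "Z - W = S" using S(2) by (auto simp: Z_def)
  have \<F>eq: "\<F> = H1 Z W (t + 1)"
    using H1_eq_image[of W t Z] finW W ZW \<F>S by (simp add: Z_def)
  \<comment> \<open>At most \<open>s\<close> of the \<open>s + 2\<close> members of
    \<open>\<F>\<close> are \<open>t\<close>-disjoint with \<open>D\<close>, so two are adjacent to
    it, and their extra points make up \<open>D - W\<close>.\<close>
  have D: "card (D \<inter> W) + 1 = t" "D - W \<subseteq> S" "card (D - W) = 2" if "D \<in> \<D>" for D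
  proof -
    have D': "finite D" "card D = t + 1" "\<not> W \<subseteq> D" "D \<in> \<G>" using that \<G> by (auto simp: \<D>_def mem_nsets)
    have "card \<F> = card {F \<in> \<F>. t_intersecting t D F} + card {F \<in> \<F>. t_disjoint t D F}"
      using fin\<F> by (subst card_Un_disjoint[symmetric]) (auto intro: arg_cong[of _ _ card])
    moreover have "card {F \<in> \<F>. t_disjoint t D F} \<le> s"
      using disj D' by (simp add: almost_cross_intersecting_def)
    ultimately have "2 \<le> card {F \<in> \<F>. t_intersecting t D F}" using card\<F> by linarith
    then obtain F1 F2 where "F1 \<in> {F \<in> \<F>. t_intersecting t D F}" "F2 \<in> {F \<in> \<F>. t_intersecting t D F}" "F1 \<noteq> F2"
      by (rule obtain_two_elements)
    then obtain x y where xy: "x \<in> S" "y \<in> S" "x \<noteq> y"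
      "t \<le> card (D \<inter> insert x W)" "t \<le> card (D \<inter> insert y W)"
      using \<F>S by (auto simp: t_intersecting_def)
    note x = card_insert_Int_notin[OF finW W(1) D'(2,1,3) xy(4)]
      and y = card_insert_Int_notin(1)[OF finW W(1) D'(2,1,3) xy(5)]
    show "card (D \<inter> W) + 1 = t" "card (D - W) = 2" by (fact x)+
    have "{x, y} = D - W" using x y xy D' by (intro card_subset_eq) auto
    then have "D - W = {x, y}" by simp
    then show "D - W \<subseteq> S" using xy by simp
  qed
  have \<D>M2: "\<D> \<subseteq> M2 Z W t"
  proof
    fix G assume G: "G \<in> \<D>"
    then have "G \<in> nsets X (t + 1)" using \<G> by (auto simp: \<D>_def)
    moreover have "G \<subseteq> Z" using D(2)[OF G] by (auto simp: Z_def)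
    ultimately show "G \<in> M2 Z W t" using D(1)[OF G] by (simp add: M2_def mem_nsets)
  qed
  have ge2: "2 \<le> card {D \<in> \<D>. z \<in> D}" if "z \<in> S" for z
  proof -
    let ?F = "insert z W"
    have F: "?F \<in> \<F>" using that by (simp add: S_def)
    have sub: "{G \<in> \<D>. t_intersecting t ?F G} \<subseteq> {D \<in> \<D>. z \<in> D}"
    proof
      fix G assume G: "G \<in> {G \<in> \<D>. t_intersecting t ?F G}"
      then have "t \<le> card (G \<inter> ?F)" by (simp add: t_intersecting_def Int_commute)
      moreover have "finite G" "card G = t + 1" "\<not> W \<subseteq> G" using G \<G> by (auto simp: \<D>_def mem_nsets)
      ultimately show "G \<in> {D \<in> \<D>. z \<in> D}"
        using G card_insert_Int_notin(1)[OF finW W(1), of G z] by blast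
    qed
    have "card {G \<in> \<D>. t_disjoint t ?F G} \<le> card {G \<in> \<G>. t_disjoint t ?F G}"
      using fin\<G> by (intro card_mono) (auto simp: \<D>_def)
    also have "\<dots> \<le> s" using disj F by (simp add: almost_cross_intersecting_def)
    finally have "card {G \<in> \<D>. t_disjoint t ?F G} \<le> s" .
    moreover have "card \<D> = card {G \<in> \<D>. t_intersecting t ?F G} + card {G \<in> \<D>. t_disjoint t ?F G}"
      using fin\<D> by (subst card_Un_disjoint[symmetric]) (auto intro: arg_cong[of _ _ card])
    moreover have "card {G \<in> \<D>. t_intersecting t ?F G} \<le> card {D \<in> \<D>. z \<in> D}"
      using sub fin\<D> by (intro card_mono) auto
    ultimately show ?thesis using card\<D> by linarith
  qed
  \<comment> \<open>The degrees sum to 2 |\<D>| = 2 |S|; since none is below 2, all equal 2.\<close>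
  have "(\<Sum>z\<in>S. card {D \<in> \<D>. z \<in> D}) = (\<Sum>D\<in>\<D>. card {z \<in> S. z \<in> D})"
    using fin\<D> S by (intro sum_multicount_gen) auto
  also have "\<dots> = (\<Sum>D\<in>\<D>. 2)"
  proof (rule sum.cong)
    fix G assume G: "G \<in> \<D>"
    have "{z \<in> S. z \<in> G} = G - W" using D(2)[OF G] S by auto
    then show "card {z \<in> S. z \<in> G} = 2" using D(3)[OF G] by simp
  qed simp
  finally have "(\<Sum>z\<in>S. 2) = (\<Sum>z\<in>S. card {D \<in> \<D>. z \<in> D})" using cardS card\<D> by simp
  then have "2 = card {D \<in> \<D>. z \<in> D}" if "z \<in> S" for z
    using sum_mono_inv[of "\<lambda>_. 2" S "\<lambda>z. card {D \<in> \<D>. z \<in> D}"] ge2 that S by blast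
  then have "\<forall>z \<in> Z - W. card {D \<in> \<D>. z \<in> D} = 2" using ZW by simp
  then show ?thesis using Z WZ \<D>M2 card\<D> \<F>eq \<G>eq by blast
qed

text \<open>\<open>L1\<close> rules out a small \<open>\<G>\<close>, via |\<F>| \<le> |\<G>|, and
  \<open>L2\<close> rules out a star with exactly two members. What survives is a singleton, or a
  star with at least three members, to which \<open>star_product_bound\<close> applies.\<close>

lemma large_product_imp_ball_or_star:
  assumes pos: "0 < t" "0 < s" and adm: "admissible_pair n t s \<F> \<G>"
    and L1: "(t + 2 + 3 * s)^2 < card \<F> * card \<G>"
    and L2: "2 * ((n - t) + t + 2 + 2 * s) < card \<F> * card \<G>"
  obtains Y where "Y \<in> nsets {1..n} (t + 1)" "\<F> = {Y}" "card \<G> \<le> card (\<G> \<inter> M1 n Y (t + 1) t) + s"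
  | W where "card W = t" "W \<subseteq> {1..n}" "\<F> \<subseteq> H1 {1..n} W (t + 1)" "3 \<le> card \<F>" "card \<F> \<le> s + 2"
      "card \<F> * card \<G> \<le> card \<F> * (n - t) + s * (card \<F> + 6)"
proof -
  have \<F>: "\<F> \<subseteq> nsets {1..n} (t + 1)" and \<G>: "\<G> \<subseteq> nsets {1..n} (t + 1)"
    and disj: "almost_cross_intersecting s t \<F> \<G>" and le: "card \<F> \<le> card \<G>"
    and ncross: "\<not> cross_intersecting t \<F> \<G>"
    using adm by (auto simp: admissible_pair_def)
  have fin: "finite \<F>" "finite \<G>"
    using \<F> \<G> by (meson finite_atLeastAtMost finite_imp_finite_nsets finite_subset)+
  have disjF: "card {G \<in> \<G>. t_disjoint t F G} \<le> s" if "F \<in> \<F>" for F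
    using disj that by (simp add: almost_cross_intersecting_def)
  have "0 < card \<F>" using ncross fin by (auto simp: cross_intersecting_def card_gt_0_iff)
  then consider "card \<F> = 1" | "2 \<le> card \<F>" by linarith
  then show thesis
  proof cases
    case 1
    then obtain Y where Y: "\<F> = {Y}" by (auto simp: card_1_singleton_iff)
    have "{G \<in> \<G>. t_intersecting t Y G} \<subseteq> \<G> \<inter> M1 n Y (t + 1) t"
      using \<G> by (auto simp: M1_def t_intersecting_def Int_commute)
    then have "card {G \<in> \<G>. t_intersecting t Y G} \<le> card (\<G> \<inter> M1 n Y (t + 1) t)"
      using fin by (intro card_mono) auto
    moreover have "card \<G> \<le> card {G \<in> \<G>. \<forall>F\<in>{Y}. t_intersecting t F G} + 1 * s"
      using fin disjF Y by (intro card_le_common_adjacent) auto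
    ultimately have "card \<G> \<le> card (\<G> \<inter> M1 n Y (t + 1) t) + s" by simp
    then show thesis using that(1) Y \<F> by blast
  next
    case 2
    have "\<not> card \<G> \<le> t + 2 + 3 * s"
    proof
      assume "card \<G> \<le> t + 2 + 3 * s"
      then have "card \<F> * card \<G> \<le> (t + 2 + 3 * s) * (t + 2 + 3 * s)" using le by (intro mult_le_mono) auto
      then show False using L1 by (simp add: power2_eq_square)
    qed
    then obtain W where W: "card W = t" "W \<subseteq> {1..n}" "\<F> \<subseteq> H1 {1..n} W (t + 1)"
      using star_or_small[OF _ \<F> \<G> disjF 2 pos] by auto
    define \<D> where "\<D> = {G \<in> \<G>. \<not> W \<subseteq> G}"
    note star = star_bounds[OF finite_atLeastAtMost W \<G> disj, folded \<D>_def]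
    have "card (\<G> \<inter> H1 {1..n} W (t + 1)) \<le> card (H1 {1..n} W (t + 1))"
      by (intro card_mono) (auto simp: H1_def finite_imp_finite_nsets)
    also have "\<dots> = n - t" using card_H1[OF finite_atLeastAtMost W(1,2)] by simp
    finally have \<G>le: "card \<G> \<le> (n - t) + card \<D>" using star(1) by simp
    \<comment> \<open>If every member of \<open>\<G>\<close> contained \<open>W\<close>, the pair
      would be cross-\<open>t\<close>-intersecting.\<close>
    have "\<D> \<noteq> {}"
    proof
      assume "\<D> = {}"
      have "t_intersecting t F G" if "F \<in> \<F>" "G \<in> \<G>" for F G
      proof -
        have "W \<subseteq> F \<inter> G" "finite (F \<inter> G)"
          using that W \<open>\<D> = {}\<close> by (auto simp: \<D>_def H1_def mem_nsets)
        then have "card W \<le> card (F \<inter> G)" by (rule card_mono[rotated])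
        then show ?thesis using W by (simp add: t_intersecting_def)
      qed
      then show False using ncross by (simp add: cross_intersecting_def)
    qed
    then have m: "card \<F> \<le> s + 2" by (rule star(2))
    have "card \<F> \<noteq> 2"
    proof
      assume two: "card \<F> = 2"
      have "card \<D> \<le> t + 2 + 2 * s"
        unfolding \<D>_def by (rule card_pair_star[OF finite_atLeastAtMost W \<G> disj 2])
      then show False using L2 two \<G>le by simp
    qed
    then have m3: "3 \<le> card \<F>" using 2 by simp
    have "card \<F> * card \<G> \<le> card \<F> * (n - t) + card \<F> * card \<D>"
      using mult_le_mono2[OF \<G>le] by (simp only: distrib_left)
    also have "card \<F> * card \<D> \<le> s * (card \<F> + 6)" using star_product_bound[OF m3 star(3)] .
    finally have "card \<F> * card \<G> \<le> card \<F> * (n - t) + s * (card \<F> + 6)" by simp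
    then show thesis using that(2) W m m3 by blast
  qed
qed

theorem theorem1p3:
  fixes n t s :: nat and \<F> \<G> :: "nat set set"
  assumes "n > 0" and "t > 0" and "s > 0"
    and "n \<ge> 5 * s * (t + 1)^2"
    and "admissible_pair n t s \<F> \<G>"
    and "\<And>\<F>' \<G>'. admissible_pair n t s \<F>' \<G>' \<Longrightarrow> card \<F>' * card \<G>' \<le> card \<F> * card \<G>"
  shows "(t \<ge> s + 2 \<longrightarrow>
           (\<exists>Y \<in> nsets {1..n} (t + 1). \<exists>\<C>.
              \<C> \<subseteq> nsets {1..n} (t + 1) - M1 n Y (t + 1) t \<and> card \<C> = s \<and>
              \<F> = {Y} \<and> \<G> = M1 n Y (t + 1) t \<union> \<C>)) \<and>
         (t \<le> s + 1 \<longrightarrow>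
           (\<exists>Z \<in> nsets {1..n} (t + s + 2). \<exists>W \<in> nsets Z t. \<exists>\<D>.
              \<D> \<subseteq> M2 Z W t \<and> card \<D> = s + 2 \<and>
              (\<forall>z \<in> Z - W. card {D \<in> \<D>. z \<in> D} = 2) \<and>
              \<F> = H1 Z W (t + 1) \<and> \<G> = H1 {1..n} W (t + 1) \<union> \<D>))"
proof (intro conjI impI)
  note pos = assms(2,3) and adm = assms(5) and max = assms(6)
  have \<G>: "\<G> \<subseteq> nsets {1..n} (t + 1)" and disj: "almost_cross_intersecting s t \<F> \<G>"
    using adm by (auto simp: admissible_pair_def)
  note n = ground_set_bounds[OF pos assms(4)]
  have "t + 1 \<le> s * (t + 1)" "2 * s \<le> s * (t + 1)"
    using mult_le_mono1[of 1 s "t + 1"] pos by simp_all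
  then have n_ge: "2 * t + 1 + s \<le> n" "t + s + 2 \<le> n" using n(1) pos by linarith+
  {
    assume ts: "s + 2 \<le> t"
    have "3 \<le> t" using ts pos by linarith
    note num = below_ball_bound[OF ts pos(2) n(2) n(3)[OF this]]
    have opt: "card (M1 n Y (t + 1) t) + s \<le> card \<F> * card \<G>" if "Y \<in> nsets {1..n} (t + 1)" for Y
      using exists_nonadjacent_family[OF that pos(1) n_ge(1)] admissible_ball[OF that _ _ pos(2)] max
      by (metis card_1_singleton_iff mult_1 One_nat_def)
    have "{1..t + 1} \<in> nsets {1..n} (t + 1)" using n_ge by (auto simp: mem_nsets)
    then have L: "(t + 1) * (n - t - 1) + 1 + s \<le> card \<F> * card \<G>" using opt card_M1 by metis
    show "\<exists>Y \<in> nsets {1..n} (t + 1). \<exists>\<C>.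
        \<C> \<subseteq> nsets {1..n} (t + 1) - M1 n Y (t + 1) t \<and> card \<C> = s \<and>
        \<F> = {Y} \<and> \<G> = M1 n Y (t + 1) t \<union> \<C>"
    proof (rule large_product_imp_ball_or_star[OF pos adm])
      show "(t + 2 + 3 * s)^2 < card \<F> * card \<G>" using num(1) L by linarith
      show "2 * ((n - t) + t + 2 + 2 * s) < card \<F> * card \<G>" using num(2) L by linarith
    next
      fix Y assume Y: "Y \<in> nsets {1..n} (t + 1)" "\<F> = {Y}"
        and le: "card \<G> \<le> card (\<G> \<inter> M1 n Y (t + 1) t) + s"
      have fin: "finite \<G>" using \<G> by (meson finite_atLeastAtMost finite_imp_finite_nsets finite_subset)
      \<comment> \<open>Maximality is compared with the ball around this same \<open>Y\<close>; as
        |\<F>| = 1, the product is |\<G>| and both estimates become equalities.\<close>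
      have ge: "card (M1 n Y (t + 1) t) + s \<le> card \<G>" using opt[OF Y(1)] Y(2) by simp
      have "card (\<G> \<inter> M1 n Y (t + 1) t) \<le> card (M1 n Y (t + 1) t)"
        using finite_M1 by (intro card_mono) auto
      then have eq: "card (\<G> \<inter> M1 n Y (t + 1) t) = card (M1 n Y (t + 1) t)"
        "card \<G> = card (M1 n Y (t + 1) t) + s"
        using ge le by linarith+
      then have "\<G> \<inter> M1 n Y (t + 1) t = M1 n Y (t + 1) t"
        using finite_M1 by (intro card_subset_eq) auto
      then have sub: "M1 n Y (t + 1) t \<subseteq> \<G>" by blast
      then have "card (\<G> - M1 n Y (t + 1) t) = s" using eq finite_M1 by (simp add: card_Diff_subset)
      then show ?thesis
        using Y \<G> sub by (intro bexI[of _ Y] exI[of _ "\<G> - M1 n Y (t + 1) t"]) auto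
    next
      fix W assume "card \<F> \<le> s + 2" "card \<F> * card \<G> \<le> card \<F> * (n - t) + s * (card \<F> + 6)"
      then show ?thesis using num(3)[of "card \<F>"] L by linarith
    qed
  }
  {
    assume ts: "t \<le> s + 1"
    note num = below_star_bound[OF ts pos(2,1) n(1)]
    have L: "(s + 2) * ((n - t) + s + 2) \<le> card \<F> * card \<G>"
      using exists_admissible_star[OF pos n_ge(2)] max by (metis add.assoc)
    show "\<exists>Z \<in> nsets {1..n} (t + s + 2). \<exists>W \<in> nsets Z t. \<exists>\<D>.
        \<D> \<subseteq> M2 Z W t \<and> card \<D> = s + 2 \<and> (\<forall>z \<in> Z - W. card {D \<in> \<D>. z \<in> D} = 2) \<and>
        \<F> = H1 Z W (t + 1) \<and> \<G> = H1 {1..n} W (t + 1) \<union> \<D>"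
    proof (rule large_product_imp_ball_or_star[OF pos adm])
      show "(t + 2 + 3 * s)^2 < card \<F> * card \<G>" using num(1) L by linarith
      show "2 * ((n - t) + t + 2 + 2 * s) < card \<F> * card \<G>" using num(2) L by linarith
    next
      fix Y assume Y: "Y \<in> nsets {1..n} (t + 1)" "\<F> = {Y}"
        and le: "card \<G> \<le> card (\<G> \<inter> M1 n Y (t + 1) t) + s"
      have "card (\<G> \<inter> M1 n Y (t + 1) t) \<le> card (M1 n Y (t + 1) t)"
        using finite_M1 by (intro card_mono) auto
      then have "card \<F> * card \<G> \<le> (t + 1) * (n - t - 1) + 1 + s"
        using le card_M1[OF Y(1)] Y(2) by simp
      then show ?thesis using num(4) L by linarith
    next
      fix W assume W: "card W = t" "W \<subseteq> {1..n}" "\<F> \<subseteq> H1 {1..n} W (t + 1)"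
        and m: "card \<F> \<le> s + 2" "card \<F> * card \<G> \<le> card \<F> * (n - t) + s * (card \<F> + 6)"
      \<comment> \<open>A star with fewer than \<open>s + 2\<close> members loses to the example,
        and the exact size then turns the product bound into the lower bound on |\<G>| that
        \<open>star_extremal\<close> needs.\<close>
      have "\<not> card \<F> \<le> s + 1" using num(3)[of "card \<F>"] L m(2) by linarith
      then have card\<F>: "card \<F> = s + 2" using m(1) by simp
      have "(s + 2) * ((n - t) + (s + 2)) \<le> (s + 2) * card \<G>" using L card\<F> by (simp only: add.assoc)
      then have "(n - t) + (s + 2) \<le> card \<G>" by (rule mult_left_le_imp_le) simp
      then show ?thesis
        using star_extremal[OF finite_atLeastAtMost W \<G> disj pos(2) card\<F>] by simp
    qed
  }
qed

end
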